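(* Let $K\ge1$ be an integer with $K\equiv\pm1\pmod6$, and let $p_1,\dots,p_r$ be the distinct primes dividing $K^2+4$. For every integer $m>1$ there exists $N$ such that for all $n\ge N$, $\pi_K^n(m)=24\cdot p_1^{j_1}\cdots p_r^{j_r}$ for some integers $j_1,\dots,j_r\ge0$.
   Context: The $K$-Fibonacci sequence is $F_{K,0}=0$, $F_{K,1}=1$, $F_{K,n}=K F_{K,n-1}+F_{K,n-2}$; for an integer $m>1$, $\pi_K(m)$ is the length of its shortest period modulo $m$; iterates are $\pi_K^1=\pi_K$ and $\pi_K^{n+1}(m)=\pi_K(\pi_K^n(m))$. *)

theory Defs
  imports "HOL-Number_Theory.Number_Theory"
begin

fun kfib :: "nat \<Rightarrow> nat \<Rightarrow> nat" where
  "kfib K 0 = 0"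
| "kfib K (Suc 0) = 1"
| "kfib K (Suc (Suc n)) = K * kfib K (Suc n) + kfib K n"

definition kfib_period :: "nat \<Rightarrow> nat \<Rightarrow> nat" where
  "kfib_period K m = (LEAST t. t > 0 \<and> (\<forall>n. [kfib K (n + t) = kfib K n] (mod m)))"

end

theory Submission
  imports Defs
begin

text \<open>
  Let \<open>\<alpha>\<close> be the positive root of \<open>x\<^sup>2 = K x + 1\<close> and \<open>D = K\<^sup>2 + 4\<close>. Since \<open>\<alpha> ^ (n + 1) = F (n + 1) \<alpha> + F n\<close>,
  a number \<open>t\<close> is a period modulo \<open>m\<close> iff \<open>\<alpha> ^ t \<equiv> 1\<close> modulo \<open>m\<close> in the ring \<open>\<int>[\<alpha>]\<close>. By Frobenius
  the period modulo a prime \<open>p\<close> divides \<open>4 p\<close> if \<open>p dvd D\<close>, and \<open>p - 1\<close> or \<open>2 (p + 1)\<close> for the other odd \<open>p\<close>;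
  passing from \<open>p ^ k\<close> to \<open>p ^ (k + 1)\<close> costs at most a factor \<open>p\<close>.

  Hence, among the primes \<open>q > 3\<close> not dividing \<open>D\<close>, the largest one in \<open>m\<close> loses an exponent at every step
  and only smaller ones can appear, so they all vanish after finitely many iterations. From then on
  the exponents of \<open>2\<close> and \<open>3\<close> decrease until they are at most \<open>3\<close> and \<open>1\<close>. Conversely the period
  is even for \<open>m > 2\<close> by Cassini's identity, and \<open>\<pi> 2 = 3\<close>, \<open>\<pi> 3 = 8\<close>, \<open>\<pi> 8 = 12\<close> force \<open>24\<close>
  to divide all late iterates.
\<close>

section \<open>The ring \<open>\<int>[\<alpha>]\<close> and congruences in it\<close>

definition quad_root :: "nat \<Rightarrow> real" where
  "quad_root K = (real K + sqrt (real K ^ 2 + 4)) / 2"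

text \<open>Realised inside the reals, so that the ring laws come for free and only closure has to
  be proved.\<close>

definition quad_ring :: "nat \<Rightarrow> real set" where
  "quad_ring K = {of_int a + of_int b * quad_root K | a b. True}"

definition quad_cong :: "nat \<Rightarrow> nat \<Rightarrow> real \<Rightarrow> real \<Rightarrow> bool" where
  "quad_cong K m x y \<longleftrightarrow> (\<exists>z\<in>quad_ring K. x - y = real m * z)"

definition is_kfib_period :: "nat \<Rightarrow> nat \<Rightarrow> nat \<Rightarrow> bool" where
  "is_kfib_period K m t \<longleftrightarrow> [kfib K t = 0] (mod m) \<and> [kfib K (Suc t) = 1] (mod m)"

lemma quad_root_square: "quad_root K ^ 2 = real K * quad_root K + 1"
proof -
  have s: "sqrt (real K ^ 2 + 4) ^ 2 = real K ^ 2 + 4" by simp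
  show ?thesis unfolding quad_root_def using s
    by (simp add: power2_eq_square field_simps)
qed

text \<open>This makes \<open>\<alpha>\<close> a unit of the ring, so factors of
  \<open>\<alpha>\<close> can be cancelled in congruences.\<close>

lemma quad_root_inverse: "quad_root K * (quad_root K - real K) = 1"
  using quad_root_square[of K] by (simp add: power2_eq_square algebra_simps)

lemma quad_ring_of_int: "of_int a \<in> quad_ring K"
  unfolding quad_ring_def by (rule CollectI, rule exI[of _ a], rule exI[of _ 0]) simp

lemma quad_ring_of_nat: "real n \<in> quad_ring K"
  using quad_ring_of_int[of "int n" K] by simp

lemma quad_ring_root: "quad_root K \<in> quad_ring K"
  unfolding quad_ring_def by (rule CollectI, rule exI[of _ 0], rule exI[of _ 1]) simp

lemma quad_ring_add:
  assumes "x \<in> quad_ring K" "y \<in> quad_ring K" shows "x + y \<in> quad_ring K"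
proof -
  obtain a b c d where "x = of_int a + of_int b * quad_root K" "y = of_int c + of_int d * quad_root K"
    using assms unfolding quad_ring_def by auto
  then have "x + y = of_int (a + c) + of_int (b + d) * quad_root K" by (simp add: algebra_simps)
  then show ?thesis unfolding quad_ring_def by blast
qed

lemma quad_ring_mult:
  assumes "x \<in> quad_ring K" "y \<in> quad_ring K" shows "x * y \<in> quad_ring K"
proof -
  obtain a b c d where xy: "x = of_int a + of_int b * quad_root K" "y = of_int c + of_int d * quad_root K"
    using assms unfolding quad_ring_def by auto
  have "x * y = of_int a * of_int c + (of_int a * of_int d + of_int b * of_int c) * quad_root K
      + of_int b * of_int d * quad_root K ^ 2"
    unfolding xy by (simp add: power2_eq_square algebra_simps)
  also have "\<dots> = of_int (a * c + b * d) + of_int (a * d + b * c + b * d * int K) * quad_root K"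
    unfolding quad_root_square by (simp add: algebra_simps)
  finally show ?thesis unfolding quad_ring_def by blast
qed

lemma quad_ring_minus: "x \<in> quad_ring K \<Longrightarrow> - x \<in> quad_ring K"
  using quad_ring_mult[OF quad_ring_of_int[of "-1" K], of x] by simp

lemma quad_ring_diff: "x \<in> quad_ring K \<Longrightarrow> y \<in> quad_ring K \<Longrightarrow> x - y \<in> quad_ring K"
  using quad_ring_add[of x K "- y"] quad_ring_minus[of y K] by simp

lemma quad_ring_power: "x \<in> quad_ring K \<Longrightarrow> x ^ n \<in> quad_ring K"
  using quad_ring_of_nat[of 1 K] by (induction n) (auto intro: quad_ring_mult)

lemma quad_ring_sum: "(\<And>i. i \<in> A \<Longrightarrow> f i \<in> quad_ring K) \<Longrightarrow> sum f A \<in> quad_ring K"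
  using quad_ring_of_nat[of 0 K] by (induction A rule: infinite_finite_induct) (auto intro: quad_ring_add)

lemma quad_cong_refl: "quad_cong K m x x"
  unfolding quad_cong_def using quad_ring_of_nat[of 0 K] by force

lemma quad_cong_sym: "quad_cong K m x y \<Longrightarrow> quad_cong K m y x"
  unfolding quad_cong_def by (metis minus_diff_eq mult_minus_right quad_ring_minus)

lemma quad_cong_add:
  assumes "quad_cong K m x y" "quad_cong K m u v" shows "quad_cong K m (x + u) (y + v)"
proof -
  obtain z w where "z \<in> quad_ring K" "w \<in> quad_ring K" "x - y = real m * z" "u - v = real m * w"
    using assms unfolding quad_cong_def by blast
  then have "z + w \<in> quad_ring K" "(x + u) - (y + v) = real m * (z + w)"
    by (auto simp: algebra_simps intro: quad_ring_add)
  then show ?thesis unfolding quad_cong_def by blast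
qed

lemma quad_cong_trans:
  assumes "quad_cong K m x y" "quad_cong K m y z" shows "quad_cong K m x z"
  using quad_cong_add[OF assms] unfolding quad_cong_def by simp

lemma quad_cong_mult_left:
  assumes "quad_cong K m x y" "c \<in> quad_ring K" shows "quad_cong K m (c * x) (c * y)"
proof -
  obtain z where "z \<in> quad_ring K" "x - y = real m * z"
    using assms unfolding quad_cong_def by blast
  then have "c * z \<in> quad_ring K" "c * x - c * y = real m * (c * z)"
    using assms(2) by (auto simp: algebra_simps simp flip: right_diff_distrib intro: quad_ring_mult)
  then show ?thesis unfolding quad_cong_def by blast
qed

lemma quad_cong_mult:
  assumes "quad_cong K m x y" "quad_cong K m u v" "x \<in> quad_ring K" "v \<in> quad_ring K"
  shows "quad_cong K m (x * u) (y * v)"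
proof (rule quad_cong_trans)
  show "quad_cong K m (x * u) (x * v)" by (rule quad_cong_mult_left) fact+
  show "quad_cong K m (x * v) (y * v)"
    using quad_cong_mult_left[OF assms(1,4)] by (simp add: mult.commute)
qed

lemma quad_cong_power:
  assumes "quad_cong K m x y" "x \<in> quad_ring K" "y \<in> quad_ring K"
  shows "quad_cong K m (x ^ n) (y ^ n)"
proof (induction n)
  case 0
  show ?case by (simp add: quad_cong_refl)
next
  case (Suc n)
  show ?case using quad_cong_mult[OF assms(1) Suc assms(2) quad_ring_power[OF assms(3)]] by simp
qed

lemma quad_cong_of_int:
  assumes "[a = b] (mod int m)" shows "quad_cong K m (of_int a) (of_int b)"
proof -
  obtain c where "a - b = int m * c" using assms unfolding cong_iff_dvd_diff dvd_def by blast
  then have "real_of_int a - of_int b = real m * of_int c"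
    by (metis of_int_diff of_int_mult of_int_of_nat_eq)
  then show ?thesis unfolding quad_cong_def using quad_ring_of_int by blast
qed

text \<open>For \<open>m = 2k + 1\<close> the integer \<open>-k\<close> is an inverse of 2 modulo
  \<open>m\<close>.\<close>

lemma quad_cong_cancel_two:
  assumes "odd m" "quad_cong K m (2 * x) (2 * y)" "x \<in> quad_ring K" "y \<in> quad_ring K"
  shows "quad_cong K m x y"
proof -
  obtain z where z: "z \<in> quad_ring K" "2 * x - 2 * y = real m * z"
    using assms unfolding quad_cong_def by blast
  obtain k where k: "m = 2 * k + 1" using assms(1) by (elim oddE)
  have "x - y = (2 * real k + 1) * (x - y) - real k * (2 * x - 2 * y)"
    by (simp add: algebra_simps)
  also have "\<dots> = real m * (x - y - real k * z)" unfolding z(2) by (simp add: k algebra_simps)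
  finally show ?thesis unfolding quad_cong_def
    using z(1) assms(3,4) quad_ring_diff quad_ring_mult quad_ring_of_nat by metis
qed

text \<open>All binomial coefficients except the two outer ones are divisible by \<open>p\<close>,
  and the cofactor of \<open>p\<close> stays in the ring.\<close>

lemma quad_cong_frobenius:
  assumes "prime p" "x \<in> quad_ring K" "y \<in> quad_ring K"
  shows "quad_cong K p ((x + y) ^ p) (x ^ p + y ^ p)"
proof -
  have p: "p \<ge> 2" using assms(1) by (rule prime_ge_2_nat)
  let ?f = "\<lambda>k. real (p choose k) * x ^ k * y ^ (p - k)"
  have "(x + y) ^ p = (\<Sum>k\<le>p. ?f k)" by (rule binomial_ring)
  also have "{..p} = insert 0 (insert p {0<..<p})" using p by auto
  also have "sum ?f \<dots> = y ^ p + (x ^ p + sum ?f {0<..<p})" using p by simp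
  finally have e: "(x + y) ^ p - (x ^ p + y ^ p) = sum ?f {0<..<p}" by simp
  have "sum ?f {0<..<p} = (\<Sum>k\<in>{0<..<p}. real p * (real ((p choose k) div p) * x ^ k * y ^ (p - k)))"
  proof (rule sum.cong[OF refl])
    fix k assume "k \<in> {0<..<p}"
    then have "p dvd (p choose k)" using assms(1) by (intro dvd_choose_prime) auto
    then have "real (p choose k) = real p * real ((p choose k) div p)"
      by (metis dvd_mult_div_cancel of_nat_mult)
    then show "?f k = real p * (real ((p choose k) div p) * x ^ k * y ^ (p - k))" by simp
  qed
  also have "\<dots> = real p * (\<Sum>k\<in>{0<..<p}. real ((p choose k) div p) * x ^ k * y ^ (p - k))"
    by (simp add: sum_distrib_left)
  finally show ?thesis unfolding quad_cong_def e
    using assms(2,3) by (blast intro: quad_ring_sum quad_ring_mult quad_ring_power quad_ring_of_nat)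
qed

text \<open>Factor \<open>x ^ p - 1\<close> as \<open>x - 1\<close> times the sum of
  \<open>x ^ i\<close> for \<open>i < p\<close>. The first factor is divisible by \<open>m\<close>.
  Since \<open>x \<equiv> 1\<close> modulo \<open>p\<close>, the sum is congruent to
  \<open>p\<close>, hence divisible by \<open>p\<close>.\<close>

lemma quad_cong_lift:
  assumes "quad_cong K m x 1" "p dvd m" "x \<in> quad_ring K"
  shows "quad_cong K (m * p) (x ^ p) 1"
proof -
  obtain z where z: "z \<in> quad_ring K" "x - 1 = real m * z"
    using assms unfolding quad_cong_def by blast
  obtain c where c: "m = p * c" using assms(2) by blast
  have 1: "quad_cong K p x 1" unfolding quad_cong_def z(2) c
    by (rule bexI[of _ "real c * z"]) (auto intro: quad_ring_mult quad_ring_of_nat z)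
  have "quad_cong K p (\<Sum>i<n. x ^ i) (real n)" for n
  proof (induction n)
    case 0
    show ?case by (simp add: quad_cong_refl)
  next
    case (Suc n)
    have "quad_cong K p (x ^ n) 1"
      using quad_cong_power[OF 1 assms(3), of n] quad_ring_of_nat[of 1 K] by simp
    from quad_cong_add[OF Suc this] show ?case by (simp add: add.commute)
  qed
  from this[of p] obtain w where w: "w \<in> quad_ring K" "(\<Sum>i<p. x ^ i) - real p = real p * w"
    unfolding quad_cong_def by blast
  have "x ^ p - 1 = (x - 1) * (\<Sum>i<p. x ^ i)" by (rule power_diff_1_eq)
  also have "(\<Sum>i<p. x ^ i) = real p * (w + 1)" using w(2) by (simp add: algebra_simps)
  finally have "x ^ p - 1 = real (m * p) * (z * (w + 1))" unfolding z(2) by simp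
  moreover have "z * (w + 1) \<in> quad_ring K"
    using z w quad_ring_of_nat[of 1 K] by (auto intro!: quad_ring_mult quad_ring_add)
  ultimately show ?thesis unfolding quad_cong_def by blast
qed

section \<open>Periods as exponents of \<open>\<alpha>\<close>\<close>

lemma odd_square_plus_4_not_square:
  fixes K :: nat and c :: int
  assumes "odd K" shows "c ^ 2 \<noteq> int (K ^ 2 + 4)"
proof
  assume h: "c ^ 2 = int (K ^ 2 + 4)"
  obtain k where k: "K = 2 * k + 1" using assms by (elim oddE)
  have "odd (c ^ 2)" unfolding h using assms by simp
  then obtain d where d: "c = 2 * d + 1" using oddE by (metis even_power zero_less_numeral)
  \<comment> \<open>The equation between odd squares, divided by 4. Products of consecutive integers
    are even, so the two sides differ in parity.\<close>
  have e: "d * (d + 1) = int k * (int k + 1) + 1"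
    using h unfolding d k by (simp add: power2_eq_square algebra_simps)
  have "even (d * (d + 1))" "even (int k * (int k + 1))" by simp_all
  then show False using e by simp
qed

text \<open>A relation with \<open>b \<noteq> 0\<close> gives \<open>2a + bK = - b \<surd>D\<close>.
  Squaring shows that \<open>b\<close> divides \<open>2a + bK\<close>, so \<open>D\<close> would be
  the square of an integer.\<close>

lemma quad_root_independent:
  assumes "odd K" "of_int a + of_int b * quad_root K = 0"
  shows "a = 0 \<and> b = 0"
proof (cases "b = 0")
  case True
  then show ?thesis using assms by simp
next
  case False
  have "real_of_int (2 * a + b * int K) = - of_int b * sqrt (real K ^ 2 + 4)"
    using assms(2) unfolding quad_root_def by (simp add: field_simps)
  then have "real_of_int (2 * a + b * int K) ^ 2 = of_int b ^ 2 * (real K ^ 2 + 4)"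
    by (simp add: power_mult_distrib)
  then have "real_of_int ((2 * a + b * int K) ^ 2) = of_int (b ^ 2 * int (K ^ 2 + 4))"
    by simp
  then have e: "(2 * a + b * int K) ^ 2 = b ^ 2 * int (K ^ 2 + 4)" by (simp only: of_int_eq_iff)
  then have "b ^ 2 dvd (2 * a + b * int K) ^ 2" by simp
  then have "b dvd 2 * a + b * int K" by (simp only: pow_divides_pow_iff)
  then obtain c where "2 * a + b * int K = b * c" by blast
  then have "c ^ 2 = int (K ^ 2 + 4)" using e False by (simp add: power_mult_distrib)
  then show ?thesis using odd_square_plus_4_not_square[OF assms(1)] by blast
qed

text \<open>Stated for \<open>Suc n\<close> so that no Fibonacci number of index -1 is
  needed.\<close>

lemma quad_root_power_Suc:
  "quad_root K ^ Suc n = real (kfib K (Suc n)) * quad_root K + real (kfib K n)"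
proof (induction n)
  case 0
  show ?case by simp
next
  case (Suc n)
  have "quad_root K ^ Suc (Suc n) = quad_root K * quad_root K ^ Suc n" by simp
  also have "\<dots> = real (kfib K (Suc n)) * quad_root K ^ 2 + real (kfib K n) * quad_root K"
    unfolding Suc by (simp add: power2_eq_square algebra_simps)
  finally show ?case unfolding quad_root_square by (simp add: algebra_simps)
qed

text \<open>Both sides say that \<open>\<alpha> ^ (t + 1) = F (t + 1) \<alpha> + F t\<close> is
  congruent to \<open>\<alpha>\<close>. One direction cancels \<open>\<alpha>\<close> through its
  inverse \<open>\<alpha> - K\<close>; the other compares coefficients by linear
  independence.\<close>

lemma is_kfib_period_iff_quad_cong:
  assumes "odd K"
  shows "is_kfib_period K m t \<longleftrightarrow> quad_cong K m (quad_root K ^ t) 1"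
proof
  assume "is_kfib_period K m t"
  then have "[int (kfib K t) = 0] (mod int m)" "[int (kfib K (Suc t)) = 1] (mod int m)"
    unfolding is_kfib_period_def by (metis cong_int_iff of_nat_0 of_nat_1)+
  from this[THEN quad_cong_of_int[where K = K]]
  have "quad_cong K m (quad_root K * real (kfib K (Suc t)) + real (kfib K t)) (quad_root K * 1 + 0)"
    by (intro quad_cong_add quad_cong_mult_left quad_ring_root) simp_all
  then have "quad_cong K m (quad_root K ^ Suc t) (quad_root K)"
    unfolding quad_root_power_Suc by (simp add: mult.commute)
  from quad_cong_mult_left[OF this, of "quad_root K - real K"]
  have "quad_cong K m ((quad_root K - real K) * quad_root K * quad_root K ^ t) ((quad_root K - real K) * quad_root K)"
    by (simp add: quad_ring_diff quad_ring_root quad_ring_of_nat mult.assoc)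
  then show "quad_cong K m (quad_root K ^ t) 1"
    using quad_root_inverse[of K] by (simp add: mult.commute)
next
  assume "quad_cong K m (quad_root K ^ t) 1"
  from quad_cong_mult_left[OF this quad_ring_root]
  obtain a b where "quad_root K ^ Suc t - quad_root K = real m * (of_int a + of_int b * quad_root K)"
    unfolding quad_cong_def quad_ring_def by auto
  then have "of_int (int (kfib K t) - int m * a) + of_int (int (kfib K (Suc t)) - 1 - int m * b) * quad_root K = 0"
    unfolding quad_root_power_Suc by (simp add: algebra_simps)
  from quad_root_independent[OF assms this]
  have "int (kfib K t) - 0 = int m * a" "int (kfib K (Suc t)) - 1 = int m * b" by simp_all
  then have "[int (kfib K t) = int 0] (mod int m)" "[int (kfib K (Suc t)) = int 1] (mod int m)"
    unfolding cong_iff_dvd_diff by simp_all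
  then show "is_kfib_period K m t" unfolding is_kfib_period_def cong_int_iff by simp
qed

lemma is_kfib_period_iff:
  "is_kfib_period K m t \<longleftrightarrow> (\<forall>n. [kfib K (n + t) = kfib K n] (mod m))"
proof
  assume h: "is_kfib_period K m t"
  have "[kfib K (n + t) = kfib K n] (mod m) \<and> [kfib K (Suc n + t) = kfib K (Suc n)] (mod m)" for n
    by (induction n) (use h in \<open>auto simp: is_kfib_period_def intro!: cong_add cong_mult\<close>)
  then show "\<forall>n. [kfib K (n + t) = kfib K n] (mod m)" by blast
next
  assume h: "\<forall>n. [kfib K (n + t) = kfib K n] (mod m)"
  from h[rule_format, of 0] h[rule_format, of 1] show "is_kfib_period K m t"
    unfolding is_kfib_period_def by simp
qed

text \<open>The witness \<open>s\<close> ensures that the least positive period \<open>d\<close>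
  exists. For any period \<open>t\<close> the remainder \<open>t mod d\<close> is again a period
  below \<open>d\<close>, so it is 0.\<close>

lemma kfib_period_dvd_iff:
  assumes "is_kfib_period K m s" "s > 0"
  shows "kfib_period K m dvd t \<longleftrightarrow> is_kfib_period K m t" and "kfib_period K m > 0"
proof -
  define d where "d = kfib_period K m"
  have d': "d = (LEAST t. t > 0 \<and> is_kfib_period K m t)"
    unfolding d_def kfib_period_def is_kfib_period_iff ..
  have d: "d > 0" "is_kfib_period K m d"
    using LeastI[of "\<lambda>t. t > 0 \<and> is_kfib_period K m t" s] assms unfolding d' by auto
  have mult: "[kfib K (n + d * k) = kfib K n] (mod m)" for n k
  proof (induction k)
    case (Suc k)
    have "[kfib K ((n + d * k) + d) = kfib K (n + d * k)] (mod m)"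
      using d(2) unfolding is_kfib_period_iff by blast
    from cong_trans[OF this Suc] show ?case by (simp add: algebra_simps)
  qed simp
  have "is_kfib_period K m (t mod d)" if t: "is_kfib_period K m t"
    unfolding is_kfib_period_iff
  proof
    fix n
    have "[kfib K (n + t mod d) = kfib K (n + t mod d + d * (t div d))] (mod m)"
      using mult cong_sym by blast
    also have "n + t mod d + d * (t div d) = n + t" by simp
    also have "[kfib K (n + t) = kfib K n] (mod m)" using t unfolding is_kfib_period_iff by blast
    finally show "[kfib K (n + t mod d) = kfib K n] (mod m)" .
  qed
  moreover have "\<not> is_kfib_period K m r" if "0 < r" "r < d" for r
    using not_less_Least[of r "\<lambda>t. t > 0 \<and> is_kfib_period K m t"] that unfolding d' by blast
  ultimately have "is_kfib_period K m t \<Longrightarrow> d dvd t"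
    using d(1) by (meson dvd_eq_mod_eq_0 mod_less_divisor neq0_conv)
  moreover have "d dvd t \<Longrightarrow> is_kfib_period K m t"
    unfolding is_kfib_period_iff using mult by (auto elim!: dvdE)
  ultimately show "kfib_period K m dvd t \<longleftrightarrow> is_kfib_period K m t" and "kfib_period K m > 0"
    using d(1) unfolding d_def by blast+
qed

lemma is_kfib_period_dvd:
  assumes "odd K" "is_kfib_period K m t" "t dvd s"
  shows "is_kfib_period K m s"
proof -
  obtain c where c: "s = t * c" using assms(3) by blast
  have "quad_cong K m (quad_root K ^ t) 1" using assms by (simp add: is_kfib_period_iff_quad_cong)
  from quad_cong_power[OF this, of c] have "quad_cong K m (quad_root K ^ s) 1"
    using quad_ring_of_nat[of 1 K] by (simp add: c power_mult quad_ring_power quad_ring_root)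
  then show ?thesis using assms(1) by (simp add: is_kfib_period_iff_quad_cong)
qed

text \<open>Each step raises the power of \<open>\<alpha>\<close> to its \<open>p\<close>-th power
  and applies \<open>quad_cong_lift\<close>.\<close>

lemma is_kfib_period_prime_power:
  assumes "odd K" "is_kfib_period K p t"
  shows "is_kfib_period K (p ^ Suc k) (t * p ^ k)"
proof (induction k)
  case 0
  show ?case using assms by simp
next
  case (Suc k)
  then have "quad_cong K (p ^ Suc k * p) ((quad_root K ^ (t * p ^ k)) ^ p) 1"
    using assms(1)
    by (intro quad_cong_lift) (auto simp: is_kfib_period_iff_quad_cong quad_ring_power quad_ring_root)
  then show ?case using assms(1)
    by (simp add: is_kfib_period_iff_quad_cong ac_simps flip: power_mult)
qed

section \<open>Periods modulo odd primes\<close>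

lemma fermat_power_cong:
  assumes "prime (p :: nat)" shows "[a ^ p = a] (mod p)"
proof (cases "p dvd a")
  case True
  then have "p dvd a ^ p" using assms by (simp add: prime_gt_0_nat dvd_power_le dvd_trans)
  then show ?thesis using True by (simp add: cong_def mod_eq_0_iff_dvd)
next
  case False
  from cong_scalar_left[OF fermat_theorem[OF assms False], of a]
  show ?thesis using assms by (simp add: prime_gt_0_nat flip: power_Suc)
qed

text \<open>Frobenius applied to \<open>2\<alpha> = K + \<surd>D\<close>, where \<open>D = K\<^sup>2 + 4\<close>.\<close>

lemma quad_root_frobenius:
  assumes "prime p" "p = 2 * h + 1"
  shows "quad_cong K p (2 * quad_root K ^ p)
    (real K + real ((K\<^sup>2 + 4) ^ h) * (2 * quad_root K - real K))"
proof -
  \<comment> \<open>This is \<open>\<surd>D\<close>; as \<open>p = 2h + 1\<close>, its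
    \<open>p\<close>-th power is \<open>D ^ h\<close> times itself.\<close>
  let ?s = "2 * quad_root K - real K"
  have s: "?s \<in> quad_ring K" using quad_ring_of_nat[of 2 K]
    by (auto intro!: quad_ring_diff quad_ring_mult quad_ring_root quad_ring_of_nat)
  have "?s ^ 2 = 4 * quad_root K ^ 2 - 4 * real K * quad_root K + real K ^ 2"
    by (simp add: power2_eq_square algebra_simps)
  then have "?s ^ 2 = real (K\<^sup>2 + 4)" unfolding quad_root_square by (simp add: algebra_simps)
  then have sp: "?s ^ p = real ((K\<^sup>2 + 4) ^ h) * ?s"
    unfolding assms(2) by (simp add: power_mult)
  have F: "quad_cong K p (real a ^ p) (real a)" for a
    using quad_cong_of_int[of "int (a ^ p)" "int a" p K] fermat_power_cong[OF assms(1), of a]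
    unfolding cong_int_iff by simp
  \<comment> \<open>Fermat replaces 2 by \<open>2 ^ p\<close>, which turns the left side into the
    \<open>p\<close>-th power of \<open>2\<alpha> = K + \<surd>D\<close>.\<close>
  have "quad_cong K p (quad_root K ^ p * 2) (quad_root K ^ p * 2 ^ p)"
    using quad_cong_sym[OF F[of 2]] by (intro quad_cong_mult_left quad_ring_power quad_ring_root) simp
  then have 1: "quad_cong K p (2 * quad_root K ^ p) ((real K + ?s) ^ p)"
    by (simp add: power_mult_distrib mult.commute)
  have 2: "quad_cong K p ((real K + ?s) ^ p) (real K ^ p + ?s ^ p)"
    by (rule quad_cong_frobenius[OF assms(1) quad_ring_of_nat s])
  have 3: "quad_cong K p (real K ^ p + ?s ^ p) (real K + ?s ^ p)"
    by (rule quad_cong_add[OF F quad_cong_refl])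
  from quad_cong_trans[OF quad_cong_trans[OF 1 2] 3] show ?thesis unfolding sp .
qed

text \<open>The term with \<open>\<surd>D\<close> vanishes modulo \<open>p\<close>, leaving
  \<open>2\<alpha> ^ p \<equiv> K\<close>. Squaring gives
  \<open>4\<alpha> ^ (2p) \<equiv> K ^ 2 \<equiv> -4\<close>, so
  \<open>\<alpha> ^ (2p) \<equiv> -1\<close>, and one more squaring gives 1.\<close>

lemma is_kfib_period_ramified:
  assumes "odd K" "prime p" "odd p" "p dvd K\<^sup>2 + 4"
  shows "is_kfib_period K p (4 * p)"
proof -
  let ?a = "quad_root K"
  obtain h where h: "p = 2 * h + 1" using assms(3) by (elim oddE)
  \<comment> \<open>Needed for \<open>p\<close> to divide \<open>D ^ h\<close>.\<close>
  have "h > 0" using h assms(2) by (cases h) auto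
  have R: "?a ^ n \<in> quad_ring K" "2 * ?a ^ n \<in> quad_ring K" for n
    using quad_ring_of_nat[of 2 K]
    by (auto intro: quad_ring_mult quad_ring_power quad_ring_root)
  have "p dvd (K\<^sup>2 + 4) ^ h" using assms(4) \<open>h > 0\<close> by (simp add: dvd_trans dvd_power)
  then have "[int ((K\<^sup>2 + 4) ^ h) = int 0] (mod int p)"
    unfolding cong_int_iff by (simp add: cong_0_iff)
  from quad_cong_of_int[OF this, of K]
  have "quad_cong K p ((2 * ?a - real K) * real ((K\<^sup>2 + 4) ^ h)) ((2 * ?a - real K) * 0)"
    using quad_ring_of_nat[of 2 K]
    by (intro quad_cong_mult_left)
       (auto intro!: quad_ring_diff quad_ring_mult quad_ring_root quad_ring_of_nat)
  from quad_cong_add[OF quad_cong_refl this, of "real K"]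
  have "quad_cong K p (real K + real ((K\<^sup>2 + 4) ^ h) * (2 * ?a - real K)) (real K)"
    by (simp add: mult.commute)
  with quad_root_frobenius[OF assms(2) h] have "quad_cong K p (2 * ?a ^ p) (real K)"
    by (rule quad_cong_trans)
  from quad_cong_power[OF this R(2) quad_ring_of_nat, of 2]
  have 1: "quad_cong K p (2 * (2 * ?a ^ (2 * p))) (real (K\<^sup>2))"
    by (simp add: power_mult_distrib power_even_eq[symmetric] flip: mult.assoc)
  have "[int (K\<^sup>2) = - 4] (mod int p)"
    unfolding cong_iff_dvd_diff using assms(4) by (metis diff_minus_eq_add of_nat_add of_nat_dvd_iff of_nat_numeral)
  from quad_cong_trans[OF 1] quad_cong_of_int[OF this, of K]
  have "quad_cong K p (2 * (2 * ?a ^ (2 * p))) (2 * (2 * (- 1)))" by simp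
  then have "quad_cong K p (2 * ?a ^ (2 * p)) (2 * (- 1))"
    using quad_ring_of_int[of "-2" K] by (intro quad_cong_cancel_two[OF assms(3) _ R(2)]) simp_all
  then have "quad_cong K p (?a ^ (2 * p)) (- 1)"
    using quad_ring_of_int[of "-1" K] by (intro quad_cong_cancel_two[OF assms(3) _ R(1)]) simp_all
  from quad_cong_power[OF this R(1), of 2] have "quad_cong K p (?a ^ (4 * p)) 1"
    using quad_ring_of_int[of "-1" K] by (simp add: power_even_eq[symmetric] flip: mult.assoc)
  then show ?thesis using assms(1) by (simp add: is_kfib_period_iff_quad_cong)
qed

text \<open>By Fermat \<open>D ^ h\<close> squares to 1, so it is 1 or -1 modulo \<open>p\<close>.
  In the first case \<open>\<alpha> ^ p \<equiv> \<alpha>\<close>, and \<open>p - 1\<close> is a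
  period. In the second \<open>\<alpha> ^ p\<close> is congruent to the conjugate
  \<open>K - \<alpha>\<close>, whose product with \<open>\<alpha>\<close> is -1, so
  \<open>2 (p + 1)\<close> is a period. The stated number is a common multiple that avoids a case
  split later.\<close>

lemma is_kfib_period_unramified:
  assumes "odd K" "prime p" "odd p" "\<not> p dvd K\<^sup>2 + 4"
  shows "is_kfib_period K p (2 * ((p - 1) * (p + 1)))"
proof -
  let ?a = "quad_root K" and ?b = "real K - quad_root K"
  obtain h where h: "p = 2 * h + 1" using assms(3) by (elim oddE)
  have R: "?a ^ n \<in> quad_ring K" "?a \<in> quad_ring K" "?b \<in> quad_ring K"
      "2 * ?a - real K \<in> quad_ring K" for n
    using quad_ring_of_nat[of 2 K]
    by (auto intro!: quad_ring_mult quad_ring_power quad_ring_root quad_ring_diff quad_ring_of_nat)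
  have ab: "?b * ?a = - 1" using quad_root_inverse[of K] by (simp add: algebra_simps)
  let ?e = "int ((K\<^sup>2 + 4) ^ h)"
  have "[(K\<^sup>2 + 4) ^ (p - 1) = 1] (mod p)" by (rule fermat_theorem[OF assms(2,4)])
  then have "[int ((K\<^sup>2 + 4) ^ (p - 1)) = int 1] (mod int p)" by (simp only: cong_int_iff)
  then have "[?e ^ 2 = 1] (mod int p)" by (simp add: h power_even_eq)
  then have "int p dvd (?e - 1) * (?e + 1)"
    unfolding cong_iff_dvd_diff by (simp add: power2_eq_square algebra_simps)
  then have "int p dvd ?e - 1 \<or> int p dvd ?e - (- 1)"
    using assms(2) prime_dvd_mult_iff[of "int p" "?e - 1" "?e + 1"] by simp
  then have "[?e = 1] (mod int p) \<or> [?e = - 1] (mod int p)"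
    unfolding cong_iff_dvd_diff .
  then obtain c :: int where c: "c = 1 \<or> c = - 1" "[?e = c] (mod int p)" by blast
  from quad_cong_mult_left[OF quad_cong_of_int[OF c(2), of K] R(4)]
  have "quad_cong K p (real ((K\<^sup>2 + 4) ^ h) * (2 * ?a - real K)) (of_int c * (2 * ?a - real K))"
    by (simp add: mult.commute)
  from quad_cong_trans[OF quad_root_frobenius[OF assms(2) h, of K] quad_cong_add[OF quad_cong_refl this]]
  have *: "quad_cong K p (2 * ?a ^ p) (real K + of_int c * (2 * ?a - real K))" .
  from c(1) show ?thesis
  proof
    assume "c = 1"
    then have "quad_cong K p (2 * ?a ^ p) (2 * ?a)" using * by simp
    then have "quad_cong K p (?a ^ p) ?a" by (rule quad_cong_cancel_two[OF assms(3) _ R(1,2)])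
    from quad_cong_mult_left[OF this R(3)]
    have "quad_cong K p (?b * ?a * ?a ^ (p - 1)) (?b * ?a)"
      by (simp add: h mult.assoc)
    then have "quad_cong K p (- (?a ^ (p - 1))) (- 1)" unfolding ab by simp
    from quad_cong_mult_left[OF this quad_ring_of_int[of "-1"]]
    have "is_kfib_period K p (p - 1)" using assms(1) by (simp add: is_kfib_period_iff_quad_cong)
    then show ?thesis by (rule is_kfib_period_dvd[OF assms(1)]) simp
  next
    assume "c = - 1"
    then have "quad_cong K p (2 * ?a ^ p) (2 * ?b)" using * by (simp add: algebra_simps)
    then have "quad_cong K p (?a ^ p) ?b" by (rule quad_cong_cancel_two[OF assms(3) _ R(1,3)])
    from quad_cong_mult_left[OF this R(2)] have "quad_cong K p (?a ^ (p + 1)) (- 1)"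
      using ab by (simp add: mult.commute)
    from quad_cong_power[OF this R(1), of 2] have "quad_cong K p (?a ^ (2 * (p + 1))) 1"
      using quad_ring_of_int[of "-1" K] unfolding power_even_eq by simp
    then have "is_kfib_period K p (2 * (p + 1))" using assms(1) by (simp add: is_kfib_period_iff_quad_cong)
    then show ?thesis by (rule is_kfib_period_dvd[OF assms(1)]) (intro mult_dvd_mono dvd_refl dvd_triv_right)
  qed
qed

section \<open>Explicit periods modulo 2, 3 and 8, and one bound for every prime\<close>

lemma kfib_cong: "[K = L] (mod m) \<Longrightarrow> [kfib K n = kfib L n] (mod m)"
  by (induction n rule: induct_nat_012) (auto intro!: cong_add cong_mult)

lemma is_kfib_period_mod: "is_kfib_period K m t \<longleftrightarrow> is_kfib_period (K mod m) m t"
proof -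
  have "[kfib K n = kfib (K mod m) n] (mod m)" for n by (rule kfib_cong) (simp add: cong_def)
  then show ?thesis unfolding is_kfib_period_def by (metis cong_sym cong_trans)
qed

lemma kfib_numeral:
  "kfib K 1 = 1"
  "2 \<le> (numeral w :: nat) \<Longrightarrow> kfib K (numeral w) = K * kfib K (numeral w - 1) + kfib K (numeral w - 2)"
proof -
  have "kfib K n = K * kfib K (n - 1) + kfib K (n - 2)" if "2 \<le> n" for n
    using le_Suc_ex[OF that] by auto
  then show "2 \<le> (numeral w :: nat) \<Longrightarrow>
      kfib K (numeral w) = K * kfib K (numeral w - 1) + kfib K (numeral w - 2)"
    by blast
qed simp

lemma is_kfib_period_2:
  assumes "odd K" shows "is_kfib_period K 2 3"
proof -
  have "K mod 2 = 1" using assms by presburger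
  then show ?thesis unfolding is_kfib_period_mod[of K]
    by (simp add: is_kfib_period_def kfib_numeral cong_def)
qed

text \<open>Every proper divisor of 8 divides 4, so excluding 4 makes the least period exactly
  8.\<close>

lemma is_kfib_period_3:
  assumes "\<not> 3 dvd K" shows "is_kfib_period K 3 8" "\<not> is_kfib_period K 3 4"
proof -
  have "K mod 3 = 1 \<or> K mod 3 = 2" using assms by presburger
  then show "is_kfib_period K 3 8" "\<not> is_kfib_period K 3 4" unfolding is_kfib_period_mod[of K]
    by (auto simp: is_kfib_period_def kfib_numeral cong_def)
qed

text \<open>Among the divisors of 12 that are multiples of 3, excluding 6 leaves only 12.\<close>

lemma not_is_kfib_period_8:
  assumes "odd K" shows "\<not> is_kfib_period K 8 6"
proof -
  have "odd (K mod 8)" "K mod 8 < 8" using assms by (simp_all add: even_mod_2_iff dvd_mod_iff)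
  then have "K mod 8 = 1 \<or> K mod 8 = 3 \<or> K mod 8 = 5 \<or> K mod 8 = 7" by presburger
  then show ?thesis unfolding is_kfib_period_mod[of K]
    by (auto simp: is_kfib_period_def kfib_numeral cong_def)
qed

text \<open>The prime 3 is treated separately: the general formula would give 16, while the final
  exponent of 2 requires the sharp value 8.\<close>

definition period_bound :: "nat \<Rightarrow> nat \<Rightarrow> nat" where
  "period_bound K p =
    (if p = 2 then 3 else if p = 3 then 8 else if p dvd K\<^sup>2 + 4 then 4 * p
     else 2 * ((p - 1) * (p + 1)))"

lemma period_bound_pos: "prime p \<Longrightarrow> period_bound K p > 0"
  using prime_ge_2_nat[of p] by (auto simp: period_bound_def)

lemma is_kfib_period_period_bound:
  assumes "odd K" "\<not> 3 dvd K" "prime p"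
  shows "is_kfib_period K p (period_bound K p)"
proof (cases "p = 2")
  case False
  then have "odd p" using assms(3) primes_dvd_imp_eq two_is_prime_nat by blast
  then show ?thesis
    using assms is_kfib_period_3(1) is_kfib_period_ramified is_kfib_period_unramified False
    by (auto simp: period_bound_def)
qed (use assms is_kfib_period_2 in \<open>simp add: period_bound_def\<close>)

section \<open>Prime powers in least common multiples, and Cassini's identity\<close>

lemma prime_power_dvd_Lcm:
  fixes q :: nat
  assumes "finite A" "prime q" "e > 0" "\<forall>x\<in>A. f x \<noteq> 0" "q ^ e dvd Lcm (f ` A)"
  shows "\<exists>x\<in>A. q ^ e dvd f x"
  using assms(1,4,5)
proof (induction A)
  case empty
  \<comment> \<open>The empty lcm is 1, which \<open>e > 0\<close> rules out.\<close>
  then show ?case using assms(2,3) by (simp add: prime_nat_iff)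
next
  case (insert x A)
  have nz: "f x \<noteq> 0" "Lcm (f ` A) \<noteq> 0"
    using insert by (auto simp: Lcm_0_iff)
  have "q ^ e dvd lcm (f x) (Lcm (f ` A))" using insert.prems by simp
  moreover have "lcm (f x) (Lcm (f ` A)) \<noteq> 0" using nz by (simp add: lcm_eq_0_iff)
  ultimately have "e \<le> multiplicity q (lcm (f x) (Lcm (f ` A)))"
    using assms(2) by (intro multiplicity_geI) auto
  \<comment> \<open>The exponent of \<open>q\<close> in an lcm is the larger of the two
    exponents.\<close>
  then have "e \<le> max (multiplicity q (f x)) (multiplicity q (Lcm (f ` A)))"
    using nz assms(2) by (simp add: multiplicity_lcm)
  then have "q ^ e dvd f x \<or> q ^ e dvd Lcm (f ` A)"
    by (auto intro: multiplicity_dvd' simp: le_max_iff_disj)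
  then show ?case using insert by auto
qed

lemma prime_power_dvd_coprime_mult:
  fixes p :: nat
  assumes "prime p" "\<not> p dvd a" "p ^ e dvd a * p ^ k" shows "e \<le> k"
proof -
  have "coprime (p ^ e) a" using assms(1,2) by (simp add: prime_imp_coprime)
  then have "p ^ e dvd p ^ k" using assms(3) by (simp add: coprime_dvd_mult_right_iff)
  then show ?thesis using prime_gt_1_nat[OF assms(1)] by (simp add: power_dvd_imp_le)
qed

lemma prime_gt_3I: "prime (p :: nat) \<Longrightarrow> p \<noteq> 2 \<Longrightarrow> p \<noteq> 3 \<Longrightarrow> p > 3"
  using prime_ge_2_nat[of p] by linarith

text \<open>The quadratic form \<open>x ^ 2 - K x y - y ^ 2\<close> changes sign at every step of
  the recurrence.\<close>

lemma kfib_cassini: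
  "int (kfib K (Suc n)) ^ 2 - int K * int (kfib K (Suc n)) * int (kfib K n) - int (kfib K n) ^ 2 = (- 1) ^ n"
proof (induction n)
  case (Suc n)
  have "int (kfib K (Suc (Suc n))) ^ 2 - int K * int (kfib K (Suc (Suc n))) * int (kfib K (Suc n)) - int (kfib K (Suc n)) ^ 2
    = - (int (kfib K (Suc n)) ^ 2 - int K * int (kfib K (Suc n)) * int (kfib K n) - int (kfib K n) ^ 2)"
    by (simp add: power2_eq_square algebra_simps)
  then show ?case unfolding Suc by simp
qed simp

section \<open>Periods of composite moduli, and the factor 24\<close>

context
  fixes K :: nat
  assumes odd_K: "odd K" and not_3_dvd_K: "\<not> 3 dvd K"
begin

text \<open>The lcm is a common multiple of periods for the prime powers in \<open>m\<close>; these
  are pairwise coprime, so the congruences combine.\<close>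

lemma is_kfib_period_Lcm:
  assumes "m > 0"
  shows "is_kfib_period K m
    (LCM p\<in>prime_factors m. period_bound K p * p ^ (multiplicity p m - 1))"
    (is "is_kfib_period K m ?T")
proof -
  have per: "is_kfib_period K (p ^ multiplicity p m) ?T" if p: "p \<in> prime_factors m" for p
  proof -
    have "prime p" using p by auto
    have "multiplicity p m > 0" using p by (simp add: prime_factors_multiplicity)
    then have "Suc (multiplicity p m - 1) = multiplicity p m" by simp
    moreover have "is_kfib_period K (p ^ Suc (multiplicity p m - 1)) (period_bound K p * p ^ (multiplicity p m - 1))"
      by (intro is_kfib_period_prime_power is_kfib_period_period_bound odd_K not_3_dvd_K \<open>prime p\<close>)
    ultimately show ?thesis using p by (metis (no_types, lifting) odd_K is_kfib_period_dvd dvd_Lcm imageI)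
  qed
  have cop: "coprime (p ^ multiplicity p m) (q ^ multiplicity q m)"
    if "p \<in> prime_factors m" "q \<in> prime_factors m" "p \<noteq> q" for p q
    using that by (auto intro: primes_coprime)
  have "is_kfib_period K (\<Prod>p\<in>prime_factors m. p ^ multiplicity p m) ?T"
    unfolding is_kfib_period_def
    using per cop by (intro conjI coprime_cong_prod_nat) (auto simp: is_kfib_period_def)
  then show ?thesis using prime_factorization_nat[OF assms] by simp
qed

lemma Lcm_period_bound_pos:
  "(LCM p\<in>prime_factors m. period_bound K p * p ^ (multiplicity p m - 1)) > 0"
proof -
  have "period_bound K p * p ^ (multiplicity p m - 1) \<noteq> 0" if "p \<in> prime_factors m" for p
    using that period_bound_pos[of p K] by (auto simp: in_prime_factors_iff)
  then have "0 \<notin> (\<lambda>p. period_bound K p * p ^ (multiplicity p m - 1)) ` prime_factors m" by force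
  then show ?thesis by (simp add: Lcm_0_iff neq0_conv[symmetric] del: neq0_conv)
qed

lemma kfib_period_dvd: "m > 0 \<Longrightarrow> kfib_period K m dvd t \<longleftrightarrow> is_kfib_period K m t"
  by (rule kfib_period_dvd_iff(1)[OF is_kfib_period_Lcm Lcm_period_bound_pos])

lemma kfib_period_pos: "m > 0 \<Longrightarrow> kfib_period K m > 0"
  by (rule kfib_period_dvd_iff(2)[OF is_kfib_period_Lcm Lcm_period_bound_pos])

lemma is_kfib_period_kfib_period: "m > 0 \<Longrightarrow> is_kfib_period K m (kfib_period K m)"
  using kfib_period_dvd[of m "kfib_period K m"] by simp

text \<open>This traces a prime power in the period back to a single prime factor of
  \<open>m\<close>; all descent arguments start here.\<close>

lemma prime_power_dvd_kfib_period:
  assumes "m > 0" "prime q" "e > 0" "q ^ e dvd kfib_period K m"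
  shows "\<exists>p\<in>prime_factors m. q ^ e dvd period_bound K p * p ^ (multiplicity p m - 1)"
proof (rule prime_power_dvd_Lcm)
  show "q ^ e dvd (LCM p\<in>prime_factors m. period_bound K p * p ^ (multiplicity p m - 1))"
    using assms(4) is_kfib_period_Lcm[OF assms(1)] kfib_period_dvd[OF assms(1)] dvd_trans by blast
  show "\<forall>p\<in>prime_factors m. period_bound K p * p ^ (multiplicity p m - 1) \<noteq> 0"
    using period_bound_pos[of _ K] by (auto simp: in_prime_factors_iff)
qed (use assms in auto)

text \<open>Period 1 would give \<open>F 1 \<equiv> 0\<close>, that is \<open>1 \<equiv> 0\<close>.
  So the iteration never leaves the range \<open>m > 1\<close>.\<close>

lemma kfib_period_gt_1:
  assumes "m > 1" shows "kfib_period K m > 1"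
proof -
  have "kfib_period K m \<noteq> 1"
    using is_kfib_period_kfib_period[of m] assms by (auto simp: is_kfib_period_def cong_def)
  then show ?thesis using kfib_period_pos[of m] assms by linarith
qed

lemma kfib_period_dvd_mono:
  assumes "d dvd m" "m > 0" shows "kfib_period K d dvd kfib_period K m"
proof -
  have "is_kfib_period K d (kfib_period K m)"
    using is_kfib_period_kfib_period[OF assms(2)] assms(1)
    unfolding is_kfib_period_def by (meson cong_dvd_modulus_nat)
  then show ?thesis using kfib_period_dvd assms dvd_pos_nat by blast
qed

text \<open>At a period \<open>t\<close> the form in Cassini's identity is congruent to 1 and equal
  to \<open>(-1) ^ t\<close>, so an odd \<open>t\<close> would force \<open>m\<close> to divide
  2.\<close>

lemma even_kfib_period:
  assumes "m > 2" shows "even (kfib_period K m)"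
proof (rule ccontr)
  define t where "t = kfib_period K m"
  assume "odd (kfib_period K m)"
  then have "odd t" by (simp add: t_def)
  have "is_kfib_period K m t" using is_kfib_period_kfib_period[of m] assms by (simp add: t_def)
  then have "[int (kfib K (Suc t)) = 1] (mod int m)" "[int (kfib K t) = 0] (mod int m)"
    unfolding is_kfib_period_def by (metis cong_int_iff of_nat_0 of_nat_1)+
  then have "[int (kfib K (Suc t)) ^ 2 - int K * int (kfib K (Suc t)) * int (kfib K t) - int (kfib K t) ^ 2
      = 1 ^ 2 - int K * 1 * 0 - 0 ^ 2] (mod int m)"
    by (intro cong_diff cong_mult cong_pow cong_refl)
  then have "[-1 = 1] (mod int m)" unfolding kfib_cassini using \<open>odd t\<close> by simp
  then have "int m dvd 2" by (simp add: cong_iff_dvd_diff)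
  then show False using assms zdvd_imp_le[of "int m" 2] by simp
qed

lemma three_dvd_kfib_period:
  assumes "m > 0" "2 dvd m" shows "3 dvd kfib_period K m"
proof -
  have "kfib_period K 2 dvd 3" using kfib_period_dvd[of 2] is_kfib_period_2[OF odd_K] by simp
  moreover have "prime (3 :: nat)" by simp
  ultimately have "kfib_period K 2 = 3" using kfib_period_gt_1[of 2] prime_nat_iff[of 3] by auto
  then show ?thesis using kfib_period_dvd_mono[OF assms(2,1)] by simp
qed

lemma eight_dvd_kfib_period:
  assumes "m > 0" "3 dvd m" shows "8 dvd kfib_period K m"
proof -
  have 1: "kfib_period K 3 dvd 2 ^ 3" using kfib_period_dvd[of 3] is_kfib_period_3[OF not_3_dvd_K] by simp
  have 2: "\<not> kfib_period K 3 dvd 2 ^ 2" using kfib_period_dvd[of 3] is_kfib_period_3[OF not_3_dvd_K] by simp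
  from 1 obtain i where i: "i \<le> 3" "kfib_period K 3 = 2 ^ i"
    using divides_primepow_nat[OF two_is_prime_nat] by blast
  have "\<not> i \<le> 2" using 2 i(2) le_imp_power_dvd by metis
  then have "i = 3" using i(1) by simp
  then show ?thesis using kfib_period_dvd_mono[OF assms(2,1)] i(2) by simp
qed

lemma twelve_dvd_kfib_period:
  assumes "m > 0" "8 dvd m" shows "12 dvd kfib_period K m"
proof -
  let ?d = "kfib_period K 8"
  have "is_kfib_period K (2 ^ Suc 2) (3 * 2 ^ 2)"
    by (rule is_kfib_period_prime_power[OF odd_K is_kfib_period_2[OF odd_K]])
  then have 1: "?d dvd 12" using kfib_period_dvd[of 8] by simp
  have 2: "\<not> ?d dvd 6" using kfib_period_dvd[of 8] not_is_kfib_period_8[OF odd_K] by simp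
  have "3 dvd ?d" by (rule three_dvd_kfib_period) simp_all
  then obtain c where c: "?d = 3 * c" by blast
  have "3 * c dvd 3 * 4" "\<not> 3 * c dvd 3 * 2" using 1 2 c by simp_all
  then have "c dvd 2 ^ 2" "\<not> c dvd 2 ^ 1" by (simp_all only: dvd_mult_cancel1 dvd_times_left_cancel_iff) simp_all
  then obtain i where i: "i \<le> 2" "c = 2 ^ i"
    using divides_primepow_nat[OF two_is_prime_nat] by blast
  have "\<not> i \<le> 1" using \<open>\<not> c dvd 2 ^ 1\<close> i(2) le_imp_power_dvd by metis
  then have "i = 2" using i(1) by simp
  then have "?d = 12" using c i(2) by simp
  then show ?thesis using kfib_period_dvd_mono[OF assms(2,1)] by simp
qed

lemma twentyfour_dvd_kfib_period:
  assumes "m > 0" "6 dvd m" shows "24 dvd kfib_period K m"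
proof -
  have "2 dvd m" "3 dvd m" by (rule dvd_trans[OF _ assms(2)], simp)+
  then have "8 dvd kfib_period K m" "3 dvd kfib_period K m"
    using assms(1) eight_dvd_kfib_period three_dvd_kfib_period by blast+
  moreover have "coprime ((2 :: nat) ^ 3) 3" unfolding coprime_power_left_iff by simp
  ultimately show ?thesis using divides_mult[of "2 ^ 3" "kfib_period K m" 3] by simp
qed

text \<open>From an even number the successive iterates are divisible by 3, 8, 12 and 24. If
  \<open>m > 2\<close>, one application makes it even; \<open>m = 2\<close> is even already.\<close>

lemma kfib_period_reaches_24:
  assumes "m > 1" shows "\<exists>n. 24 dvd (kfib_period K ^^ n) m"
proof -
  let ?f = "kfib_period K"
  have pos: "x > 0 \<Longrightarrow> ?f x > 0" for x by (rule kfib_period_pos)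
  have ev: "24 dvd (?f ^^ 4) x" if "x > 0" "2 dvd x" for x
  proof -
    have "3 dvd ?f x" using that by (rule three_dvd_kfib_period)
    then have "8 dvd ?f (?f x)" using that by (intro eight_dvd_kfib_period pos)
    then have "12 dvd ?f (?f (?f x))" using that by (intro twelve_dvd_kfib_period pos)
    then have "6 dvd ?f (?f (?f x))" by (rule dvd_trans[rotated]) simp
    then have "24 dvd ?f (?f (?f (?f x)))" using that by (intro twentyfour_dvd_kfib_period pos)
    then show ?thesis by (simp add: numeral_eq_Suc)
  qed
  have gt2: "\<exists>n. 24 dvd (?f ^^ n) x" if "x > 2" for x
  proof -
    have "24 dvd (?f ^^ 4) (?f x)" using that pos even_kfib_period by (intro ev) auto
    then have "24 dvd (?f ^^ Suc 4) x" by (simp only: funpow_Suc_right o_apply)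
    then show ?thesis by blast
  qed
  show ?thesis
  proof (cases "m = 2")
    case True
    then show ?thesis using ev[of m] by auto
  next
    case False
    then show ?thesis using gt2 assms by simp
  qed
qed

section \<open>Disappearance of the primes above 3 that do not divide \<open>D\<close>\<close>

definition transient_prime :: "nat \<Rightarrow> bool" where
  "transient_prime q \<longleftrightarrow> prime q \<and> q > 3 \<and> \<not> q dvd K\<^sup>2 + 4"

text \<open>Let \<open>p\<close> be the prime factor of \<open>m\<close> responsible for
  \<open>q ^ e\<close>. If \<open>p\<close> is 2, 3 or a divisor of \<open>D\<close>, its term
  contains only 2, 3 and \<open>p\<close>, none of which is \<open>q\<close>. So \<open>p\<close> is
  transient. If \<open>p = q\<close>, the bound is prime to \<open>p\<close> and one exponent is
  lost; otherwise \<open>q\<close> divides \<open>p - 1\<close> or \<open>p + 1\<close>, and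
  \<open>q < p\<close>.\<close>

lemma transient_prime_descent:
  assumes "m > 0" "transient_prime q" "e > 0" "q ^ e dvd kfib_period K m"
  shows "q ^ Suc e dvd m \<or> (\<exists>p>q. transient_prime p \<and> p dvd m)"
proof -
  have q: "prime q" "q > 3" "\<not> q dvd K\<^sup>2 + 4" using assms(2) by (auto simp: transient_prime_def)
  obtain p where p: "p \<in> prime_factors m" "q ^ e dvd period_bound K p * p ^ (multiplicity p m - 1)"
    using prime_power_dvd_kfib_period[OF assms(1) q(1) assms(3,4)] by blast
  have "prime p" "p dvd m" using p(1) by auto
  have "q dvd period_bound K p * p ^ (multiplicity p m - 1)"
    using p(2) assms(3) by (meson dvd_power dvd_trans)
  then have d: "q dvd period_bound K p \<or> q = p"
    using q(1) \<open>prime p\<close> by (metis prime_dvd_mult_iff prime_dvd_power primes_dvd_imp_eq)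
  have small: "\<not> q dvd 2" "\<not> q dvd 3" using q(2) by (auto dest: dvd_imp_le)
  have q8: "\<not> q dvd 2 ^ k" for k using small(1) q(1) prime_dvd_power by blast
  have "p \<noteq> 2" using d small(2) q(2) by (auto simp: period_bound_def)
  moreover have "p \<noteq> 3" using d q8[of 3] q(2) by (auto simp: period_bound_def)
  ultimately have p3: "p > 3" using \<open>prime p\<close> prime_gt_3I by blast
  have nD: "\<not> p dvd K\<^sup>2 + 4"
  proof
    assume D: "p dvd K\<^sup>2 + 4"
    then have "q dvd 2 ^ 2 * p \<or> q = p" using d p3 by (auto simp: period_bound_def)
    then have "q = p" using q(1) \<open>prime p\<close> q8 by (metis prime_dvd_mult_iff primes_dvd_imp_eq)
    then show False using D q(3) by simp
  qed
  then have tp: "transient_prime p" using \<open>prime p\<close> p3 by (simp add: transient_prime_def)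
  have b: "period_bound K p = 2 * ((p - 1) * (p + 1))" using p3 nD by (simp add: period_bound_def)
  have dv: "r dvd p - 1 \<or> r dvd p + 1" if "prime r" "\<not> r dvd 2" "r dvd period_bound K p" for r
    using that unfolding b by (auto simp only: prime_dvd_mult_iff)
  show ?thesis
  proof (cases "q = p")
    case True
    have "\<not> p dvd p - 1" using p3 by (auto dest: dvd_imp_le)
    moreover have "\<not> p dvd p + 1" using p3 dvd_add_right_iff[of p p 1] by auto
    ultimately have "\<not> p dvd period_bound K p" using dv[of p] \<open>prime p\<close> small(1) True by blast
    from prime_power_dvd_coprime_mult[OF \<open>prime p\<close> this] p(2) True
    have "e \<le> multiplicity p m - 1" by simp
    then have "Suc e \<le> multiplicity p m" using assms(3) by simp
    then show ?thesis using True multiplicity_dvd' by blast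
  next
    case False
    then have "q dvd p - 1 \<or> q dvd p + 1" using d dv[OF q(1) small(1)] by blast
    then have "q \<le> p + 1" using p3 by (auto dest: dvd_imp_le)
    \<comment> \<open>Both primes are odd.\<close>
    moreover have "q \<noteq> p + 1"
      using prime_odd_nat[OF q(1)] prime_odd_nat[OF \<open>prime p\<close>] q(2) p3 by auto
    ultimately have "q < p" using False by simp
    then show ?thesis using tp \<open>p dvd m\<close> by blast
  qed
qed

definition transient_free :: "nat \<Rightarrow> bool" where
  "transient_free m \<longleftrightarrow> m > 1 \<and> (\<forall>q. transient_prime q \<longrightarrow> \<not> q dvd m)"

lemma transient_free_kfib_period: "transient_free m \<Longrightarrow> transient_free (kfib_period K m)"
  using kfib_period_gt_1[of m] transient_prime_descent[of m _ 1]
  unfolding transient_free_def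
  by (metis One_nat_def dvd_power dvd_trans less_imp_le less_numeral_extra(1) order_less_trans power_one_right zero_less_Suc)

text \<open>Double induction: the outer one on a strict bound \<open>M\<close> for the transient
  primes in \<open>m\<close>, the inner one on the exponent of the largest prime then
  allowed.\<close>

lemma reaches_transient_free_below:
  assumes "m > 1" "\<And>q. transient_prime q \<Longrightarrow> q dvd m \<Longrightarrow> q < M"
  shows "\<exists>n. transient_free ((kfib_period K ^^ n) m)"
  using assms
proof (induction M arbitrary: m)
  case 0
  then have "transient_free m" by (auto simp: transient_free_def)
  then show ?case by (metis funpow_0)
next
  case (Suc M)
  note IH_M = Suc.IH
  \<comment> \<open>Here \<open>e\<close> bounds the exponent of \<open>M\<close> in
    \<open>x\<close>. With no transient prime above \<open>M\<close>, each application lowers this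
    bound by one; once \<open>M\<close> is gone, the outer hypothesis applies.\<close>
  have inner: "\<exists>n. transient_free ((kfib_period K ^^ n) x)"
    if "x > 1" "\<And>q. transient_prime q \<Longrightarrow> q dvd x \<Longrightarrow> q \<le> M" "\<not> M ^ Suc e dvd x" for x e
    using that
  proof (induction e arbitrary: x)
    case 0
    then have "q < M" if "transient_prime q" "q dvd x" for q
      using that by (metis le_neq_implies_less power_one_right One_nat_def)
    then show ?case using IH_M 0 by blast
  next
    case (Suc e)
    show ?case
    proof (cases "transient_prime M")
      case False
      then have "q < M" if "transient_prime q" "q dvd x" for q
        using that Suc.prems(2) by (metis le_neq_implies_less)
      then show ?thesis using IH_M Suc.prems(1) by blast
    next
      case True
      have x0: "x > 0" using Suc.prems(1) by simp
      have "\<exists>n. transient_free ((kfib_period K ^^ n) (kfib_period K x))"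
      proof (rule Suc.IH)
        show "kfib_period K x > 1" by (rule kfib_period_gt_1) fact
        show "q \<le> M" if q: "transient_prime q" "q dvd kfib_period K x" for q
        proof -
          have "q ^ Suc 1 dvd x \<or> (\<exists>p>q. transient_prime p \<and> p dvd x)"
            using q by (intro transient_prime_descent[OF x0]) auto
          moreover have "q dvd x" if "q ^ Suc 1 dvd x" using that by (simp add: dvd_mult_left)
          ultimately show ?thesis using Suc.prems(2) q(1) by fastforce
        qed
        show "\<not> M ^ Suc e dvd kfib_period K x"
          using transient_prime_descent[OF x0 True, of "Suc e"] Suc.prems(2,3) by force
      qed
      then show ?thesis by (metis funpow_Suc_right o_apply)
    qed
  qed
  show ?case
  proof (cases "transient_prime M")
    case True
    then have "2 \<le> M" by (simp add: transient_prime_def)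
    \<comment> \<open>A crude initial exponent: \<open>M ^ (m + 1)\<close> exceeds \<open>m\<close>,
      so it cannot divide it.\<close>
    then have "2 ^ Suc m \<le> M ^ Suc m" by (rule power_mono) simp
    moreover have "m < 2 ^ Suc m" using less_exp[of "Suc m"] by linarith
    ultimately have "\<not> M ^ Suc m dvd m" using Suc.prems(1) by (auto dest: dvd_imp_le)
    then show ?thesis using inner Suc.prems by (metis less_Suc_eq_le)
  next
    case False
    then have "q < M" if "transient_prime q" "q dvd m" for q
      using that Suc.prems(2) by (metis less_antisym)
    then show ?thesis using Suc.IH Suc.prems(1) by blast
  qed
qed

lemma reaches_transient_free:
  assumes "m > 1" shows "\<exists>n. transient_free ((kfib_period K ^^ n) m)"
  using assms by (intro reaches_transient_free_below[of m "Suc m"]) (auto dest: dvd_imp_le)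

section \<open>Lowering the exponents of 2 and 3\<close>

lemma square_plus_4_coprime_6: "\<not> 2 dvd K\<^sup>2 + 4" "\<not> 3 dvd K\<^sup>2 + 4"
proof -
  show "\<not> 2 dvd K\<^sup>2 + 4" using odd_K by simp
  have "K mod 3 = 1 \<or> K mod 3 = 2" using not_3_dvd_K by presburger
  then have "(K\<^sup>2) mod 3 = 1" using power_mod[of K 3 2] by auto
  then show "\<not> 3 dvd K\<^sup>2 + 4" by presburger
qed

text \<open>Without transient primes the bounds are only 3, 8 and \<open>4 * p\<close>. Primes other
  than \<open>r\<close> thus contribute at most \<open>2 ^ 3\<close> or \<open>3 ^ 1\<close>, which
  explains \<open>c\<close>. A higher power must come from the prime \<open>r\<close> itself, whose
  bound is prime to \<open>r\<close>, so one exponent is lost.\<close>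

lemma transient_free_descent:
  assumes "transient_free m" "r = 2 \<and> c = 3 \<or> r = 3 \<and> c = 1" "e > c" "r ^ e dvd kfib_period K m"
  shows "r ^ Suc e dvd m"
proof -
  have m: "m > 0" using assms(1) by (simp add: transient_free_def)
  have r: "prime r" "\<not> r dvd K\<^sup>2 + 4" using assms(2) square_plus_4_coprime_6 by auto
  have e: "e > 0" using assms(3) by simp
  obtain p where p: "p \<in> prime_factors m" "r ^ e dvd period_bound K p * p ^ (multiplicity p m - 1)"
    using prime_power_dvd_kfib_period[OF m r(1) e assms(4)] by blast
  have pp: "prime p" "p dvd m" using p(1) by auto
  have b: "period_bound K p = (if p = 2 then 3 else if p = 3 then 8 else 4 * p)"
    using pp assms(1) prime_gt_3I[of p]
    by (auto simp: period_bound_def transient_free_def transient_prime_def)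
  show ?thesis
  proof (cases "p = r")
    case True
    have "\<not> r dvd period_bound K p" using assms(2) True unfolding b by auto
    from prime_power_dvd_coprime_mult[OF r(1) this] p(2) True
    have "e \<le> multiplicity p m - 1" by simp
    then have "Suc e \<le> multiplicity p m" using e by simp
    then show ?thesis using True multiplicity_dvd' by blast
  next
    case False
    have np: "\<not> r dvd p" using False r(1) pp(1) primes_dvd_imp_eq by blast
    have "coprime (r ^ e) (p ^ (multiplicity p m - 1))" using False r(1) pp(1) by (auto intro: primes_coprime)
    then have *: "r ^ e dvd period_bound K p" using p(2) by (simp add: coprime_dvd_mult_left_iff)
    \<comment> \<open>Split off the \<open>r\<close>-part: for \<open>r = 2\<close> from 8 or
      \<open>4 * p\<close>, for \<open>r = 3\<close> from 3 or \<open>4 * p\<close>.\<close>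
    have "\<exists>a k. period_bound K p = a * r ^ k \<and> k \<le> c \<and> \<not> r dvd a"
      using assms(2)
    proof
      assume rc: "r = 2 \<and> c = 3"
      show ?thesis
      proof (cases "p = 3")
        case True
        then show ?thesis using rc b by (intro exI[of _ 1] exI[of _ 3]) simp
      next
        case F: False
        then show ?thesis using rc b np False by (intro exI[of _ p] exI[of _ 2]) simp
      qed
    next
      assume rc: "r = 3 \<and> c = 1"
      show ?thesis
      proof (cases "p = 2")
        case True
        then show ?thesis using rc b by (intro exI[of _ 1] exI[of _ 1]) simp
      next
        case F: False
        have "\<not> 3 dvd 4 * p" using np rc by presburger
        then show ?thesis using rc b F False by (intro exI[of _ "4 * p"] exI[of _ 0]) simp
      qed
    qed
    then obtain a k where "period_bound K p = a * r ^ k" "k \<le> c" "\<not> r dvd a" by blast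
    then have "e \<le> c" using prime_power_dvd_coprime_mult[OF r(1), of a e k] * by simp
    then show ?thesis using assms(3) by simp
  qed
qed

lemma transient_free_funpow: "transient_free m \<Longrightarrow> transient_free ((kfib_period K ^^ n) m)"
  by (induction n) (auto intro: transient_free_kfib_period)

text \<open>The descent lowers a bound on the exponent until it reaches \<open>c\<close>;
  \<open>r ^ m > m\<close> supplies the initial bound.\<close>

lemma transient_free_reaches:
  assumes "transient_free m" "r = 2 \<and> c = 3 \<or> r = 3 \<and> c = 1"
  shows "\<exists>n. \<not> r ^ Suc c dvd (kfib_period K ^^ n) m"
proof -
  have *: "\<exists>n. \<not> r ^ Suc c dvd (kfib_period K ^^ n) x" if "transient_free x" "\<not> r ^ e dvd x" for e x
    using that
  proof (induction e arbitrary: x)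
    case (Suc e)
    show ?case
    proof (cases "e > c")
      case True
      then have "\<not> r ^ e dvd kfib_period K x"
        using transient_free_descent[OF Suc.prems(1) assms(2)] Suc.prems(2) by blast
      from Suc.IH[OF transient_free_kfib_period[OF Suc.prems(1)] this]
      show ?thesis by (metis funpow_Suc_right o_apply)
    next
      case False
      then have "r ^ Suc e dvd r ^ Suc c" by (intro le_imp_power_dvd) simp
      then have "\<not> r ^ Suc c dvd (kfib_period K ^^ 0) x" using Suc.prems(2) dvd_trans by auto
      then show ?thesis by blast
    qed
  qed simp
  have "2 ^ m \<le> r ^ m" using assms(2) by (intro power_mono) auto
  then have "m < r ^ m" using less_exp[of m] by linarith
  moreover have "m > 0" using assms(1) by (simp add: transient_free_def)
  ultimately have "\<not> r ^ m dvd m" by (auto dest: dvd_imp_le)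
  then show ?thesis using * assms(1) by blast
qed

section \<open>The limiting form of the iterates\<close>

definition limiting :: "nat \<Rightarrow> bool" where
  "limiting m \<longleftrightarrow> transient_free m \<and> \<not> 2 ^ Suc 3 dvd m \<and> \<not> 3 ^ Suc 1 dvd m \<and> 24 dvd m"

lemma not_dvd_kfib_period:
  assumes "transient_free m" "r = 2 \<and> c = 3 \<or> r = 3 \<and> c = 1" "\<not> r ^ Suc c dvd m"
  shows "\<not> r ^ Suc c dvd kfib_period K m"
  using transient_free_descent[OF assms(1,2), of "Suc c"] assms(3)
  by (metis dvd_trans le_imp_power_dvd lessI less_imp_le)

lemma not_dvd_funpow:
  assumes "transient_free m" "r = 2 \<and> c = 3 \<or> r = 3 \<and> c = 1" "\<not> r ^ Suc c dvd m"
  shows "\<not> r ^ Suc c dvd (kfib_period K ^^ n) m"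
  by (induction n) (use assms not_dvd_kfib_period transient_free_funpow in \<open>simp_all del: power_Suc\<close>)

lemma limiting_kfib_period:
  assumes "limiting m" shows "limiting (kfib_period K m)"
proof -
  have m: "transient_free m" "m > 0" "24 dvd m" using assms by (auto simp: limiting_def transient_free_def)
  have "6 dvd m" using m(3) by (rule dvd_trans[rotated]) simp
  then show ?thesis unfolding limiting_def
    using m transient_free_kfib_period twentyfour_dvd_kfib_period
      not_dvd_kfib_period[OF m(1), of 2 3] not_dvd_kfib_period[OF m(1), of 3 1] assms
    by (simp add: limiting_def del: power_Suc)
qed

lemma limiting_funpow: "limiting m \<Longrightarrow> limiting ((kfib_period K ^^ n) m)"
  by (induction n) (auto intro: limiting_kfib_period)

text \<open>Transient primes go first, since the descent for 2 and 3 presupposes their absence. Each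
  property, once reached, survives further iteration, so the stages can be run one after
  another.\<close>

lemma reaches_limiting:
  assumes "m > 1" shows "\<exists>n. limiting ((kfib_period K ^^ n) m)"
proof -
  let ?f = "kfib_period K"
  obtain n1 where 1: "transient_free ((?f ^^ n1) m)" using reaches_transient_free[OF assms] by blast
  define m1 where "m1 = (?f ^^ n1) m"
  obtain n2 where 2: "\<not> 2 ^ Suc 3 dvd (?f ^^ n2) m1"
    using transient_free_reaches[of m1 2 3] 1 unfolding m1_def by blast
  define m2 where "m2 = (?f ^^ n2) m1"
  have t2: "transient_free m2" using 1 transient_free_funpow by (simp add: m1_def m2_def)
  obtain n3 where 3: "\<not> 3 ^ Suc 1 dvd (?f ^^ n3) m2"
    using transient_free_reaches[OF t2, of 3 1] by blast
  define m3 where "m3 = (?f ^^ n3) m2"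
  have t3: "transient_free m3" using t2 transient_free_funpow by (simp add: m3_def)
  have 23: "\<not> 2 ^ Suc 3 dvd m3"
    using not_dvd_funpow[OF t2, of 2 3 n3] 2 by (simp add: m3_def m2_def del: power_Suc)
  obtain n4 where 4: "24 dvd (?f ^^ n4) m3"
    using kfib_period_reaches_24[of m3] t3 by (auto simp: transient_free_def)
  have "limiting ((?f ^^ n4) m3)" unfolding limiting_def
    using transient_free_funpow[OF t3] not_dvd_funpow[OF t3, of 2 3] not_dvd_funpow[OF t3, of 3 1] 23 3 4
    by (simp add: m3_def del: power_Suc)
  then have "limiting ((?f ^^ (n4 + n3 + n2 + n1)) m)"
    by (simp add: m1_def m2_def m3_def funpow_add)
  then show ?thesis by blast
qed

text \<open>As 24 divides \<open>m\<close> but 16 and 9 do not, the cofactor \<open>c\<close> is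
  prime to 6, and its remaining primes are not transient, so they divide \<open>D\<close>.\<close>

lemma limiting_factorization:
  assumes "limiting m"
  shows "\<exists>j. m = 24 * (\<Prod>p\<in>prime_factors (K\<^sup>2 + 4). p ^ j p)"
proof -
  obtain c where c: "m = 24 * c" using assms unfolding limiting_def by blast
  have m: "m > 0" "\<And>q. transient_prime q \<Longrightarrow> \<not> q dvd m" "\<not> 16 dvd m" "\<not> 9 dvd m"
    using assms by (auto simp: limiting_def transient_free_def)
  then have "c > 0" using c by simp
  have sub: "prime_factors c \<subseteq> prime_factors (K\<^sup>2 + 4)"
  proof
    fix p assume "p \<in> prime_factors c"
    then have p: "prime p" "p dvd c" by auto
    have "p \<noteq> 2"
    proof
      assume "p = 2"
      then obtain d where "c = 2 * d" using p(2) by blast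
      then have "m = 16 * (3 * d)" using c by simp
      then show False using m(3) dvd_triv_left by blast
    qed
    moreover have "p \<noteq> 3"
    proof
      assume "p = 3"
      then obtain d where "c = 3 * d" using p(2) by blast
      then have "m = 9 * (8 * d)" using c by simp
      then show False using m(4) dvd_triv_left by blast
    qed
    ultimately have "p > 3" using p(1) prime_gt_3I by blast
    moreover have "\<not> transient_prime p" using m(2) p(2) c dvd_mult by blast
    ultimately have "p dvd K\<^sup>2 + 4" using p(1) by (auto simp: transient_prime_def)
    then show "p \<in> prime_factors (K\<^sup>2 + 4)" using p(1) by (simp add: in_prime_factors_iff)
  qed
  have "c = (\<Prod>p\<in>prime_factors c. p ^ multiplicity p c)"
    by (rule prime_factorization_nat[OF \<open>c > 0\<close>])
  \<comment> \<open>The additional primes have exponent 0 in \<open>c\<close> and contribute factors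
    1.\<close>
  also have "\<dots> = (\<Prod>p\<in>prime_factors (K\<^sup>2 + 4). p ^ multiplicity p c)"
    using sub by (intro prod.mono_neutral_left) (auto simp: prime_factors_multiplicity[of c])
  finally have "m = 24 * (\<Prod>p\<in>prime_factors (K\<^sup>2 + 4). p ^ multiplicity p c)" using c by simp
  then show ?thesis by (intro exI[of _ "\<lambda>p. multiplicity p c"])
qed

end

theorem theorem4p5:
  fixes K m :: nat
  assumes "K \<ge> 1"
    and "[int K = 1] (mod 6) \<or> [int K = - 1] (mod 6)"
    and "m > 1"
  shows "\<exists>N\<ge>1. \<forall>n\<ge>N. \<exists>j :: nat \<Rightarrow> nat.
    (kfib_period K ^^ n) m = 24 * (\<Prod>p\<in>prime_factors (K\<^sup>2 + 4). p ^ j p)"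
proof -
  have "int K mod 6 = 1 \<or> int K mod 6 = 5" using assms(2) by (simp add: cong_def)
  moreover have "int K mod 6 = int (K mod 6)" by (simp add: of_nat_mod)
  ultimately have "K mod 6 = 1 \<or> K mod 6 = 5" by linarith
  then have K: "odd K" "\<not> 3 dvd K" by presburger+
  obtain N where N: "limiting K ((kfib_period K ^^ N) m)"
    using reaches_limiting[OF K assms(3)] by blast
  \<comment> \<open>\<open>Suc N\<close> replaces \<open>N\<close> because the threshold has to be
    at least 1.\<close>
  have "limiting K ((kfib_period K ^^ n) m)" if "n \<ge> Suc N" for n
  proof -
    have "limiting K ((kfib_period K ^^ (n - N)) ((kfib_period K ^^ N) m))"
      by (rule limiting_funpow[OF K N])
    also have "(kfib_period K ^^ (n - N)) ((kfib_period K ^^ N) m) = (kfib_period K ^^ (n - N + N)) m"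
      by (simp only: funpow_add o_apply)
    finally show ?thesis using that by simp
  qed
  then have "\<forall>n\<ge>Suc N. \<exists>j. (kfib_period K ^^ n) m = 24 * (\<Prod>p\<in>prime_factors (K\<^sup>2 + 4). p ^ j p)"
    using limiting_factorization[OF K] by blast
  then show ?thesis by (intro exI[of _ "Suc N"]) simp
qed

end
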